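(* Let $\mathsf{T}$ be a time category and let $\tau \colon \mathsf{S} \hookrightarrow \mathsf{T}$ be a sub-join-semilattice of $\mathsf{T}$. Then, for any category $\mathsf{C}$ with limits (resp. colimits), there is a functor $(- \circ \tau)$, given by precomposition with $\tau$, taking persistent (resp. cumulative) $\mathsf{C}$-narratives with time $\mathsf{T}$ to narratives of the same kind with time $\mathsf{S}$; that is, a functor $\mathsf{Pe}(\mathsf{T},\mathsf{C}) \to \mathsf{Pe}(\mathsf{S},\mathsf{C})$, $F \mapsto F \circ \tau^{op}$ (resp. $\mathsf{Cu}(\mathsf{T},\mathsf{C}) \to \mathsf{Cu}(\mathsf{S},\mathsf{C})$, $F \mapsto F \circ \tau$).
   Context: Let $\mathsf{I}$ (resp. $\mathsf{I}_{\mathbb{N}}$) be the poset, regarded as a category, whose objects are the closed intervals $[a,b]$ ($a \le b$) of $\mathbb{R}$ (resp. of $\mathbb{N}$) and whose morphisms are the inclusions of intervals. It is a join-semilattice: the join of two intervals is the smallest closed interval containing both. A time category is any sub-join-semilattice $\mathsf{T}$ of $\mathsf{I}$ or of $\mathsf{I}_{\mathbb{N}}$, regarded as a posetal category; in particular a sub-join-semilattice of a time category is again a time category. A cover of an interval $[a,b]$ is a pair $([a,p],[p,b])$ with $a \le p \le b$; for a time category $\mathsf{T}$, one considers those covers for which $[a,b],[a,p],[p,b],[p,p]$ are objects of $\mathsf{T}$. For a category $\mathsf{C}$ with pullbacks, a $\mathsf{C}$-valued sheaf on $\mathsf{T}$ is a functor $F \colon \mathsf{T}^{op} \to \mathsf{C}$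 such that for every interval $[a,b]$ and every cover $([a,p],[p,b])$ of it, $F([a,b])$ (with the restriction maps) is the pullback $F([a,p]) \times_{F([p,p])} F([p,b])$. For a category $\mathsf{C}$ with pushouts, a $\mathsf{C}$-valued cosheaf on $\mathsf{T}$ is a functor $\hat{F} \colon \mathsf{T} \to \mathsf{C}$ such that for every interval $[a,b]$ and every cover $([a,p],[p,b])$ of it, $\hat{F}([a,b])$ is the pushout $\hat{F}([a,p]) +_{\hat{F}([p,p])} \hat{F}([p,b])$. $\mathsf{Pe}(\mathsf{T},\mathsf{C})$ denotes the category of $\mathsf{C}$-valued sheaves on $\mathsf{T}$ (persistent $\mathsf{C}$-narratives with time $\mathsf{T}$) and $\mathsf{Cu}(\mathsf{T},\mathsf{C})$ the category of $\mathsf{C}$-valued cosheaves on $\mathsf{T}$ (cumulative $\mathsf{C}$-narratives with time $\mathsf{T}$); in both cases morphisms are natural transformations. *)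

theory Defs
  imports
    "HOL-Library.FuncSet"
    "HOL-Library.Interval"
    "HOL-Library.Infinite_Typeclass"
begin

section \<open>Categories, functors and natural transformations\<close>

text \<open>\<open>Comp C g f\<close> is the composite ``f, then g''.\<close>

record ('o, 'a) cat =
  Obj :: "'o set"
  Arr :: "'a set"
  Dom :: "'a \<Rightarrow> 'o"
  Cod :: "'a \<Rightarrow> 'o"
  Ide :: "'o \<Rightarrow> 'a"
  Comp :: "'a \<Rightarrow> 'a \<Rightarrow> 'a"

definition in_hom :: "('o, 'a) cat \<Rightarrow> 'a \<Rightarrow> 'o \<Rightarrow> 'o \<Rightarrow> bool" where
  "in_hom C f x y \<longleftrightarrow> f \<in> Arr C \<and> Dom C f = x \<and> Cod C f = y"

locale category =
  fixes C :: "('o, 'a) cat"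
  assumes Dom_in: "f \<in> Arr C \<Longrightarrow> Dom C f \<in> Obj C"
    and Cod_in: "f \<in> Arr C \<Longrightarrow> Cod C f \<in> Obj C"
    and Ide_hom: "x \<in> Obj C \<Longrightarrow> in_hom C (Ide C x) x x"
    and Comp_hom: "\<lbrakk>in_hom C f x y; in_hom C g y z\<rbrakk> \<Longrightarrow> in_hom C (Comp C g f) x z"
    and Comp_Ide_right: "in_hom C f x y \<Longrightarrow> Comp C f (Ide C x) = f"
    and Comp_Ide_left: "in_hom C f x y \<Longrightarrow> Comp C (Ide C y) f = f"
    and Comp_assoc: "\<lbrakk>in_hom C f w x; in_hom C g x y; in_hom C h y z\<rbrakk>
          \<Longrightarrow> Comp C h (Comp C g f) = Comp C (Comp C h g) f"

definition op_cat :: "('o, 'a) cat \<Rightarrow> ('o, 'a) cat" where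
  "op_cat C = C\<lparr>Dom := Cod C, Cod := Dom C, Comp := (\<lambda>g f. Comp C f g)\<rparr>"

definition full_subcategory :: "('o, 'a) cat \<Rightarrow> ('o \<Rightarrow> bool) \<Rightarrow> ('o, 'a) cat" where
  "full_subcategory C P =
     C\<lparr>Obj := {x \<in> Obj C. P x}, Arr := {f \<in> Arr C. P (Dom C f) \<and> P (Cod C f)}\<rparr>"

text \<open>
  The maps of a functor, and the components of a natural transformation, are extensional
  (\<open>undefined\<close> outside the source category), so that HOL equality of these records is
  equality of functors and of natural transformations.
\<close>

record ('o, 'a, 'p, 'b) functr =
  fobj :: "'o \<Rightarrow> 'p"
  farr :: "'a \<Rightarrow> 'b"

locale is_functor = A: category A + B: category B
  for A :: "('o, 'a) cat" and B :: "('p, 'b) cat" +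
  fixes F :: "('o, 'a, 'p, 'b) functr"
  assumes fobj_in: "fobj F \<in> Obj A \<rightarrow>\<^sub>E Obj B"
    and farr_in: "farr F \<in> Arr A \<rightarrow>\<^sub>E Arr B"
    and farr_hom: "in_hom A f x y \<Longrightarrow> in_hom B (farr F f) (fobj F x) (fobj F y)"
    and farr_Ide: "x \<in> Obj A \<Longrightarrow> farr F (Ide A x) = Ide B (fobj F x)"
    and farr_Comp: "\<lbrakk>in_hom A f x y; in_hom A g y z\<rbrakk>
          \<Longrightarrow> farr F (Comp A g f) = Comp B (farr F g) (farr F f)"

record ('o, 'a, 'p, 'b) nattrans =
  src :: "('o, 'a, 'p, 'b) functr"
  trg :: "('o, 'a, 'p, 'b) functr"
  cmpt :: "'o \<Rightarrow> 'b"

locale natural_transformation =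
  F: is_functor A B "src \<eta>" + G: is_functor A B "trg \<eta>"
  for A :: "('o, 'a) cat" and B :: "('p, 'b) cat" and \<eta> :: "('o, 'a, 'p, 'b) nattrans" +
  assumes cmpt_ext: "cmpt \<eta> \<in> extensional (Obj A)"
    and cmpt_hom: "x \<in> Obj A \<Longrightarrow> in_hom B (cmpt \<eta> x) (fobj (src \<eta>) x) (fobj (trg \<eta>) x)"
    and naturality: "in_hom A f x y
          \<Longrightarrow> Comp B (cmpt \<eta> y) (farr (src \<eta>) f) = Comp B (farr (trg \<eta>) f) (cmpt \<eta> x)"

definition functor_category ::
  "('o, 'a) cat \<Rightarrow> ('p, 'b) cat
    \<Rightarrow> (('o, 'a, 'p, 'b) functr, ('o, 'a, 'p, 'b) nattrans) cat" where
  "functor_category A B =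
     \<lparr>Obj = {F. is_functor A B F},
      Arr = {\<eta>. natural_transformation A B \<eta>},
      Dom = src,
      Cod = trg,
      Ide = (\<lambda>F. \<lparr>src = F, trg = F, cmpt = (\<lambda>x\<in>Obj A. Ide B (fobj F x))\<rparr>),
      Comp = (\<lambda>\<theta> \<eta>. \<lparr>src = src \<eta>, trg = trg \<theta>,
                      cmpt = (\<lambda>x\<in>Obj A. Comp B (cmpt \<theta> x) (cmpt \<eta> x))\<rparr>)\<rparr>"

text \<open>
  Composition with a functor \<open>K\<close> whose source category is \<open>A\<close>; \<open>A\<close> is needed only to make
  the results extensional.
\<close>

definition comp_functor ::
  "('o, 'a) cat \<Rightarrow> ('p, 'b, 'q, 'c) functr \<Rightarrow> ('o, 'a, 'p, 'b) functr \<Rightarrow> ('o, 'a, 'q, 'c) functr" where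
  "comp_functor A F K =
     \<lparr>fobj = (\<lambda>x\<in>Obj A. fobj F (fobj K x)), farr = (\<lambda>f\<in>Arr A. farr F (farr K f))\<rparr>"

definition whisker ::
  "('o, 'a) cat \<Rightarrow> ('p, 'b, 'q, 'c) nattrans \<Rightarrow> ('o, 'a, 'p, 'b) functr \<Rightarrow> ('o, 'a, 'q, 'c) nattrans" where
  "whisker A \<eta> K =
     \<lparr>src = comp_functor A (src \<eta>) K, trg = comp_functor A (trg \<eta>) K,
      cmpt = (\<lambda>x\<in>Obj A. cmpt \<eta> (fobj K x))\<rparr>"

text \<open>Precomposition with \<open>K\<close>, as a functor whose source \<open>D\<close> is a category of functors.\<close>

definition precomposition ::
  "(('p, 'b, 'q, 'c) functr, ('p, 'b, 'q, 'c) nattrans) cat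
    \<Rightarrow> ('o, 'a) cat \<Rightarrow> ('o, 'a, 'p, 'b) functr
    \<Rightarrow> (('p, 'b, 'q, 'c) functr, ('p, 'b, 'q, 'c) nattrans,
        ('o, 'a, 'q, 'c) functr, ('o, 'a, 'q, 'c) nattrans) functr" where
  "precomposition D A K =
     \<lparr>fobj = (\<lambda>F\<in>Obj D. comp_functor A F K), farr = (\<lambda>\<eta>\<in>Arr D. whisker A \<eta> K)\<rparr>"


section \<open>Limits and colimits\<close>

definition is_cone ::
  "('i, 'j) cat \<Rightarrow> ('o, 'a) cat \<Rightarrow> ('i, 'j, 'o, 'a) functr \<Rightarrow> 'o \<Rightarrow> ('i \<Rightarrow> 'a) \<Rightarrow> bool" where
  "is_cone J C D L \<pi> \<longleftrightarrow> L \<in> Obj C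
     \<and> (\<forall>i\<in>Obj J. in_hom C (\<pi> i) L (fobj D i))
     \<and> (\<forall>u\<in>Arr J. Comp C (farr D u) (\<pi> (Dom J u)) = \<pi> (Cod J u))"

definition is_limit ::
  "('i, 'j) cat \<Rightarrow> ('o, 'a) cat \<Rightarrow> ('i, 'j, 'o, 'a) functr \<Rightarrow> 'o \<Rightarrow> ('i \<Rightarrow> 'a) \<Rightarrow> bool" where
  "is_limit J C D L \<pi> \<longleftrightarrow> is_cone J C D L \<pi>
     \<and> (\<forall>M \<mu>. is_cone J C D M \<mu> \<longrightarrow>
          (\<exists>!h. in_hom C h M L \<and> (\<forall>i\<in>Obj J. Comp C (\<pi> i) h = \<mu> i)))"

text \<open>
  The type \<open>'u\<close> plays the role of the universe that fixes what a small diagram is: the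
  shapes are the categories with objects and arrows in \<open>'u\<close>. Since \<open>'u\<close> is infinite, every
  finite shape is among them up to isomorphism, in particular those of pullbacks.
\<close>

definition has_limits :: "'u::infinite itself \<Rightarrow> ('o, 'a) cat \<Rightarrow> bool" where
  "has_limits _ C \<longleftrightarrow> (\<forall>(J :: ('u, 'u) cat) D. is_functor J C D \<longrightarrow> (\<exists>L \<pi>. is_limit J C D L \<pi>))"

definition has_colimits :: "'u::infinite itself \<Rightarrow> ('o, 'a) cat \<Rightarrow> bool" where
  "has_colimits u C \<longleftrightarrow> has_limits u (op_cat C)"

text \<open>\<open>p\<close> and \<open>q\<close> are the projections from a pullback of the cospan \<open>f\<close>, \<open>g\<close>.\<close>

definition is_pullback :: "('o, 'a) cat \<Rightarrow> 'a \<Rightarrow> 'a \<Rightarrow> 'a \<Rightarrow> 'a \<Rightarrow> bool" where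
  "is_pullback C f g p q \<longleftrightarrow>
     (\<exists>X Y Z P. in_hom C f X Z \<and> in_hom C g Y Z \<and> in_hom C p P X \<and> in_hom C q P Y
       \<and> Comp C f p = Comp C g q
       \<and> (\<forall>Q p' q'. in_hom C p' Q X \<and> in_hom C q' Q Y \<and> Comp C f p' = Comp C g q' \<longrightarrow>
            (\<exists>!h. in_hom C h Q P \<and> Comp C p h = p' \<and> Comp C q h = q')))"

text \<open>\<open>i\<close> and \<open>j\<close> are the injections into a pushout of the span \<open>f\<close>, \<open>g\<close>.\<close>

definition is_pushout :: "('o, 'a) cat \<Rightarrow> 'a \<Rightarrow> 'a \<Rightarrow> 'a \<Rightarrow> 'a \<Rightarrow> bool" where
  "is_pushout C f g i j \<longleftrightarrow> is_pullback (op_cat C) f g i j"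


section \<open>Time categories\<close>

text \<open>\<open>(U, V)\<close> is the unique arrow from \<open>U\<close> to \<open>V\<close> when \<open>U \<le> V\<close>.\<close>

definition posetal :: "'p::order set \<Rightarrow> ('p, 'p \<times> 'p) cat" where
  "posetal T =
     \<lparr>Obj = T,
      Arr = {(U, V). U \<in> T \<and> V \<in> T \<and> U \<le> V},
      Dom = fst,
      Cod = snd,
      Ide = (\<lambda>U. (U, U)),
      Comp = (\<lambda>g f. (fst f, snd g))\<rparr>"

text \<open>
  The inclusion \<open>\<tau>\<close> of a subset \<open>S\<close> in any larger poset. A functor and its opposite have
  the same object and arrow maps, so this record serves both for \<open>\<tau>\<close> and for \<open>\<tau>\<^sup>o\<^sup>p\<close>.
\<close>

definition inclusion :: "'p::order set \<Rightarrow> ('p, 'p \<times> 'p, 'p, 'p \<times> 'p) functr" where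
  "inclusion S = \<lparr>fobj = (\<lambda>U\<in>S. U), farr = (\<lambda>f\<in>Arr (posetal S). f)\<rparr>"

definition sub_join_semilattice :: "'p::semilattice_sup set \<Rightarrow> 'p set \<Rightarrow> bool" where
  "sub_join_semilattice S T \<longleftrightarrow> S \<subseteq> T \<and> (\<forall>U\<in>S. \<forall>V\<in>S. sup U V \<in> S)"

text \<open>
  The posets of closed intervals of the reals and of the naturals are the types
  \<^typ>\<open>real interval\<close> and \<^typ>\<open>nat interval\<close>, whose order is inclusion and whose \<open>sup\<close> is
  the smallest closed interval containing both arguments.
\<close>

definition time_category :: "'t::lattice interval set \<Rightarrow> bool" where
  "time_category T \<longleftrightarrow> sub_join_semilattice T UNIV"

text \<open>
  \<open>(V, W)\<close> is the cover \<open>([a, p], [p, b])\<close> of \<open>U = [a, b]\<close>. As \<open>V\<close> and \<open>W\<close> are intervals,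
  \<open>a \<le> p \<le> b\<close> holds automatically.
\<close>

definition is_cover :: "'t::lattice interval \<Rightarrow> 't \<Rightarrow> 't interval \<Rightarrow> 't interval \<Rightarrow> bool" where
  "is_cover U p V W \<longleftrightarrow>
     lower V = lower U \<and> upper V = p \<and> lower W = p \<and> upper W = upper U"

type_synonym ('t, 'o, 'a) narrative =
  "('t interval, 't interval \<times> 't interval, 'o, 'a) functr"

definition is_sheaf :: "'t::lattice interval set \<Rightarrow> ('o, 'a) cat \<Rightarrow> ('t, 'o, 'a) narrative \<Rightarrow> bool" where
  "is_sheaf T C F \<longleftrightarrow> is_functor (op_cat (posetal T)) C F
     \<and> (\<forall>U p V W. is_cover U p V W \<and> {U, V, W, interval_of p} \<subseteq> T \<longrightarrow>
          is_pullback C (farr F (interval_of p, V)) (farr F (interval_of p, W))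
                        (farr F (V, U)) (farr F (W, U)))"

definition is_cosheaf :: "'t::lattice interval set \<Rightarrow> ('o, 'a) cat \<Rightarrow> ('t, 'o, 'a) narrative \<Rightarrow> bool" where
  "is_cosheaf T C F \<longleftrightarrow> is_functor (posetal T) C F
     \<and> (\<forall>U p V W. is_cover U p V W \<and> {U, V, W, interval_of p} \<subseteq> T \<longrightarrow>
          is_pushout C (farr F (interval_of p, V)) (farr F (interval_of p, W))
                       (farr F (V, U)) (farr F (W, U)))"

type_synonym ('t, 'o, 'a) narrative_cat =
  "(('t, 'o, 'a) narrative,
    ('t interval, 't interval \<times> 't interval, 'o, 'a) nattrans) cat"

definition Pe :: "'t::lattice interval set \<Rightarrow> ('o, 'a) cat \<Rightarrow> ('t, 'o, 'a) narrative_cat" where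
  "Pe T C = full_subcategory (functor_category (op_cat (posetal T)) C) (is_sheaf T C)"

definition Cu :: "'t::lattice interval set \<Rightarrow> ('o, 'a) cat \<Rightarrow> ('t, 'o, 'a) narrative_cat" where
  "Cu T C = full_subcategory (functor_category (posetal T) C) (is_cosheaf T C)"

end

theory Submission
  imports Defs
begin

text \<open>
  Precomposition with a functor \<open>K: A \<rightarrow> B\<close> is a functor from the \<open>C\<close>-valued functors on \<open>B\<close> to
  those on \<open>A\<close>, and it restricts to full subcategories as soon as it maps the selected objects to
  selected objects. For \<open>K = \<tau>\<close> the latter holds because a cover in \<open>S\<close> is a cover in \<open>T\<close>, and
  \<open>F \<circ> \<tau>\<close> agrees with \<open>F\<close> on its arrows.
\<close>

section \<open>Opposite categories, posets and full subcategories\<close>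

lemma in_hom_op_cat [simp]: "in_hom (op_cat C) f x y \<longleftrightarrow> in_hom C f y x"
  by (auto simp: in_hom_def op_cat_def)

lemma op_cat_simps [simp]:
  "Obj (op_cat C) = Obj C" "Arr (op_cat C) = Arr C" "Dom (op_cat C) = Cod C"
  "Cod (op_cat C) = Dom C" "Ide (op_cat C) = Ide C"
  "Comp (op_cat C) g f = Comp C f g"
  by (simp_all add: op_cat_def)

lemma category_op_cat:
  assumes "category C"
  shows "category (op_cat C)"
proof -
  interpret category C by fact
  show ?thesis
    \<comment> \<open>Composition is reversed in the opposite category, so its associativity law is
      the original one with its two sides exchanged.\<close>
    by (intro category.intro)
      (auto simp: Dom_in Cod_in Ide_hom Comp_Ide_left Comp_Ide_right
        intro: Comp_hom Comp_assoc[symmetric])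
qed

text \<open>Reversing arrows leaves the object and arrow maps alone, so one record represents both
  functors. This is how \<open>inclusion S\<close> comes to act as the opposite inclusion, along
  which sheaves are restricted.\<close>

lemma is_functor_op_cat:
  assumes "is_functor A B F"
  shows "is_functor (op_cat A) (op_cat B) F"
proof -
  interpret is_functor A B F by fact
  show ?thesis
    by (intro is_functor.intro is_functor_axioms.intro)
      (use A.category_axioms B.category_axioms fobj_in farr_in in
        \<open>auto intro: category_op_cat farr_hom farr_Ide farr_Comp\<close>)
qed

lemma in_hom_posetal: "in_hom (posetal T) f U V \<longleftrightarrow> f = (U, V) \<and> U \<in> T \<and> V \<in> T \<and> U \<le> V"
  by (cases f) (auto simp: in_hom_def posetal_def)

lemma category_posetal: "category (posetal T)"
  \<comment> \<open>Arrows are first turned into explicit pairs. Unfolding \<open>posetal\<close>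
    any earlier would destroy the pattern that \<open>in_hom_posetal\<close> rewrites.\<close>
  by unfold_locales (auto simp: in_hom_posetal, auto simp: posetal_def)

section \<open>Full subcategories\<close>

lemma in_hom_full_subcategory:
  "in_hom (full_subcategory C P) f x y \<longleftrightarrow> in_hom C f x y \<and> P x \<and> P y"
  by (auto simp: in_hom_def full_subcategory_def)

lemma full_subcategory_simps [simp]:
  "Obj (full_subcategory C P) = {x \<in> Obj C. P x}"
  "Arr (full_subcategory C P) = {f \<in> Arr C. P (Dom C f) \<and> P (Cod C f)}"
  "Dom (full_subcategory C P) = Dom C" "Cod (full_subcategory C P) = Cod C"
  "Ide (full_subcategory C P) = Ide C" "Comp (full_subcategory C P) = Comp C"
  by (simp_all add: full_subcategory_def)

lemma category_full_subcategory:
  assumes "category C"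
  shows "category (full_subcategory C P)"
proof -
  interpret category C by fact
  show ?thesis
    by unfold_locales
      (auto simp: in_hom_full_subcategory Dom_in Cod_in Ide_hom Comp_Ide_left Comp_Ide_right
        intro: Comp_hom Comp_assoc)
qed

section \<open>Functor categories and precomposition\<close>

lemma functor_category_simps [simp]:
  "Obj (functor_category A B) = {F. is_functor A B F}"
  "Arr (functor_category A B) = {\<eta>. natural_transformation A B \<eta>}"
  "Dom (functor_category A B) = src" "Cod (functor_category A B) = trg"
  "Ide (functor_category A B) F = \<lparr>src = F, trg = F, cmpt = (\<lambda>x\<in>Obj A. Ide B (fobj F x))\<rparr>"
  "Comp (functor_category A B) \<theta> \<eta> =
     \<lparr>src = src \<eta>, trg = trg \<theta>, cmpt = (\<lambda>x\<in>Obj A. Comp B (cmpt \<theta> x) (cmpt \<eta> x))\<rparr>"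
  by (simp_all add: functor_category_def)

lemma in_hom_functor_category:
  "in_hom (functor_category A B) \<eta> F G \<longleftrightarrow>
     natural_transformation A B \<eta> \<and> src \<eta> = F \<and> trg \<eta> = G"
  by (simp add: in_hom_def)

lemma (in category) in_hom_Obj:
  assumes "in_hom C f x y"
  shows "x \<in> Obj C" "y \<in> Obj C"
  using assms Dom_in Cod_in by (auto simp: in_hom_def)

lemma natural_transformation_Ide:
  assumes "is_functor A B F"
  shows "natural_transformation A B (Ide (functor_category A B) F)"
proof -
  interpret is_functor A B F by fact
  show ?thesis
  proof (intro natural_transformation.intro natural_transformation_axioms.intro)
    fix x assume "x \<in> Obj A"
    then show "in_hom B (cmpt (Ide (functor_category A B) F) x)
        (fobj (src (Ide (functor_category A B) F)) x) (fobj (trg (Ide (functor_category A B) F)) x)"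
      using fobj_in by (auto intro!: B.Ide_hom)
  next
    fix f x y assume f: "in_hom A f x y"
    show "Comp B (cmpt (Ide (functor_category A B) F) y) (farr (src (Ide (functor_category A B) F)) f)
        = Comp B (farr (trg (Ide (functor_category A B) F)) f) (cmpt (Ide (functor_category A B) F) x)"
      using A.in_hom_Obj[OF f] farr_hom[OF f]
      by (simp add: B.Comp_Ide_left B.Comp_Ide_right)
  qed (use assms in auto)
qed

text \<open>The naturality squares of \<eta> and \<theta> are pasted along their common side, the
  image of \<open>f\<close> under \<open>trg \<eta>\<close>, with associativity used before, between
  and after.\<close>

lemma natural_transformation_Comp:
  assumes "natural_transformation A B \<eta>" "natural_transformation A B \<theta>" "trg \<eta> = src \<theta>"
  shows "natural_transformation A B (Comp (functor_category A B) \<theta> \<eta>)"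
proof -
  interpret \<eta>: natural_transformation A B \<eta> by fact
  interpret \<theta>: natural_transformation A B \<theta> by fact
  show ?thesis
  proof (intro natural_transformation.intro natural_transformation_axioms.intro)
    fix x assume x: "x \<in> Obj A"
    then show "in_hom B (cmpt (Comp (functor_category A B) \<theta> \<eta>) x)
        (fobj (src (Comp (functor_category A B) \<theta> \<eta>)) x)
        (fobj (trg (Comp (functor_category A B) \<theta> \<eta>)) x)"
      using \<eta>.F.B.Comp_hom[OF \<eta>.cmpt_hom[OF x]] \<theta>.cmpt_hom[OF x] assms(3) by simp
  next
    fix f x y assume f: "in_hom A f x y"
    note xy = \<eta>.F.A.in_hom_Obj[OF f]
    note \<eta>x = \<eta>.cmpt_hom[OF xy(1)] and \<eta>y = \<eta>.cmpt_hom[OF xy(2)]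
    \<comment> \<open>Folding replaces \<open>src \<theta>\<close> by \<open>trg \<eta>\<close>, so
      that the components of \<theta> start literally where those of \<eta> end, as
      \<open>Comp_assoc\<close> requires.\<close>
    note \<theta>x = \<theta>.cmpt_hom[OF xy(1), folded assms(3)] and \<theta>y = \<theta>.cmpt_hom[OF xy(2), folded assms(3)]
    have "Comp B (Comp B (cmpt \<theta> y) (cmpt \<eta> y)) (farr (src \<eta>) f)
        = Comp B (cmpt \<theta> y) (Comp B (farr (trg \<eta>) f) (cmpt \<eta> x))"
      using \<eta>.F.B.Comp_assoc[OF \<eta>.F.farr_hom[OF f] \<eta>y \<theta>y] \<eta>.naturality[OF f] by simp
    also have "\<dots> = Comp B (Comp B (farr (trg \<theta>) f) (cmpt \<theta> x)) (cmpt \<eta> x)"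
      using \<eta>.F.B.Comp_assoc[OF \<eta>x \<eta>.G.farr_hom[OF f] \<theta>y] \<theta>.naturality[OF f] assms(3) by simp
    also have "\<dots> = Comp B (farr (trg \<theta>) f) (Comp B (cmpt \<theta> x) (cmpt \<eta> x))"
      using \<eta>.F.B.Comp_assoc[OF \<eta>x \<theta>x \<theta>.G.farr_hom[OF f]] by simp
    finally show "Comp B (cmpt (Comp (functor_category A B) \<theta> \<eta>) y)
          (farr (src (Comp (functor_category A B) \<theta> \<eta>)) f)
        = Comp B (farr (trg (Comp (functor_category A B) \<theta> \<eta>)) f)
          (cmpt (Comp (functor_category A B) \<theta> \<eta>) x)"
      using xy by simp
  qed (use \<eta>.F.is_functor_axioms \<theta>.G.is_functor_axioms in auto)
qed

text \<open>Extensionality fixes both component maps to \<open>undefined\<close> off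
  \<open>X\<close>, so agreement on \<open>X\<close> is enough for equality of the records.\<close>

lemma nattrans_eqI:
  fixes \<eta> \<theta> :: "('o, 'a, 'p, 'b) nattrans"
  assumes "src \<eta> = src \<theta>" "trg \<eta> = trg \<theta>" "cmpt \<eta> \<in> extensional X" "cmpt \<theta> \<in> extensional X"
    and "\<And>x. x \<in> X \<Longrightarrow> cmpt \<eta> x = cmpt \<theta> x"
  shows "\<eta> = \<theta>"
  using assms by (intro nattrans.equality extensionalityI) auto

text \<open>The laws hold componentwise in \<open>B\<close>. That \<open>A\<close> and
  \<open>B\<close> are categories is part of \<open>is_functor\<close>, hence comes with every
  object and every arrow of the functor category.\<close>

lemma category_functor_category: "category (functor_category A B)"
proof (unfold_locales, goal_cases)
  case (1 \<eta>)
  then show ?case by (simp add: natural_transformation_def)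
next
  case (2 \<eta>)
  then show ?case by (simp add: natural_transformation_def)
next
  case (3 F)
  then show ?case
    using natural_transformation_Ide by (auto simp: in_hom_functor_category)
next
  case (4 \<eta> F G \<theta> H)
  then show ?case
    using natural_transformation_Comp[of A B \<eta> \<theta>] by (auto simp: in_hom_functor_category)
next
  case (5 \<eta> F G)
  then interpret natural_transformation A B \<eta> by (simp add: in_hom_functor_category)
  show ?case
    using 5 cmpt_ext cmpt_hom F.B.Comp_Ide_right
    by (intro nattrans_eqI[where X = "Obj A"]) (auto simp: in_hom_functor_category)
next
  case (6 \<eta> F G)
  then interpret natural_transformation A B \<eta> by (simp add: in_hom_functor_category)
  show ?case
    using 6 cmpt_ext cmpt_hom F.B.Comp_Ide_left
    by (intro nattrans_eqI[where X = "Obj A"]) (auto simp: in_hom_functor_category)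
next
  case (7 \<eta> F G \<theta> H \<kappa> K)
  interpret \<eta>: natural_transformation A B \<eta> using 7 by (simp add: in_hom_functor_category)
  interpret \<theta>: natural_transformation A B \<theta> using 7 by (simp add: in_hom_functor_category)
  interpret \<kappa>: natural_transformation A B \<kappa> using 7 by (simp add: in_hom_functor_category)
  have "Comp B (cmpt \<kappa> x) (Comp B (cmpt \<theta> x) (cmpt \<eta> x)) = Comp B (Comp B (cmpt \<kappa> x) (cmpt \<theta> x)) (cmpt \<eta> x)"
    if x: "x \<in> Obj A" for x
    using 7 \<eta>.cmpt_hom[OF x] \<theta>.cmpt_hom[OF x] \<kappa>.cmpt_hom[OF x]
    by (intro \<eta>.F.B.Comp_assoc) (auto simp: in_hom_functor_category)
  then show ?case
    by (intro nattrans_eqI[where X = "Obj A"]) auto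
qed

section \<open>Composition of functors and whiskering\<close>

lemma is_functor_comp_functor:
  assumes "is_functor A B K" "is_functor B C F"
  shows "is_functor A C (comp_functor A F K)"
proof -
  interpret K: is_functor A B K by fact
  interpret F: is_functor B C F by fact
  \<comment> \<open>The arrow map of \<open>comp_functor\<close> is restricted to
    \<open>Arr A\<close>; it evaluates only once membership is known.\<close>
  have Arr: "f \<in> Arr A" if "in_hom A f x y" for f x y
    using that by (simp add: in_hom_def)
  show ?thesis
  proof (unfold_locales, goal_cases)
    case 1
    show ?case using K.fobj_in F.fobj_in by (auto simp: comp_functor_def)
  next
    case 2
    show ?case using K.farr_in F.farr_in by (auto simp: comp_functor_def)
  next
    case (3 f x y)
    then show ?case
      using Arr K.A.in_hom_Obj[OF 3] F.farr_hom[OF K.farr_hom[OF 3]] by (simp add: comp_functor_def)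
  next
    case (4 x)
    then show ?case
      using Arr[OF K.A.Ide_hom[OF 4]] PiE_mem[OF K.fobj_in 4]
      by (simp add: comp_functor_def K.farr_Ide F.farr_Ide)
  next
    case (5 f x y g z)
    then show ?case
      using K.A.Comp_hom[OF 5] F.farr_Comp[OF K.farr_hom[OF 5(1)] K.farr_hom[OF 5(2)]]
      by (simp add: comp_functor_def Arr K.farr_Comp)
  qed
qed

text \<open>The naturality square at an arrow \<open>f\<close> of \<open>A\<close> is the square of
  \<eta> at \<open>farr K f\<close>.\<close>

lemma natural_transformation_whisker:
  assumes "is_functor A B K" "natural_transformation B C \<eta>"
  shows "natural_transformation A C (whisker A \<eta> K)"
proof -
  interpret K: is_functor A B K by fact
  interpret \<eta>: natural_transformation B C \<eta> by fact
  show ?thesis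
  proof (intro natural_transformation.intro natural_transformation_axioms.intro, goal_cases)
    case (4 x)
    then show ?case
      using \<eta>.cmpt_hom[of "fobj K x"] K.fobj_in by (auto simp: whisker_def comp_functor_def)
  next
    case (5 f x y)
    then show ?case
      using K.A.in_hom_Obj[OF 5] \<eta>.naturality[OF K.farr_hom[OF 5]]
      by (simp add: whisker_def comp_functor_def in_hom_def)
  qed (use \<eta>.F.is_functor_axioms \<eta>.G.is_functor_axioms in
      \<open>auto simp: whisker_def intro!: is_functor_comp_functor[OF assms(1)]\<close>)
qed

text \<open>Whiskering merely reindexes components along \<open>K\<close>, so it preserves
  identities and composites, which are formed componentwise. Keeping \<open>P\<close> and
  \<open>Q\<close> abstract lets sheaves and cosheaves share one proof.\<close>

lemma is_functor_precomposition:
  assumes K: "is_functor A B K"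
    and PQ: "\<And>F. \<lbrakk>is_functor B C F; P F\<rbrakk> \<Longrightarrow> Q (comp_functor A F K)"
  shows "is_functor (full_subcategory (functor_category B C) P)
    (full_subcategory (functor_category A C) Q)
    (precomposition (full_subcategory (functor_category B C) P) A K)"
proof -
  interpret K: is_functor A B K by fact
  interpret BC: category "full_subcategory (functor_category B C) P"
    by (intro category_full_subcategory category_functor_category)
  have nat: "natural_transformation A C (whisker A \<eta> K)" "Q (src (whisker A \<eta> K))"
      "Q (trg (whisker A \<eta> K))"
    if "natural_transformation B C \<eta>" "P (src \<eta>)" "P (trg \<eta>)" for \<eta>
  proof -
    interpret natural_transformation B C \<eta> by fact
    show "natural_transformation A C (whisker A \<eta> K)" "Q (src (whisker A \<eta> K))"
        "Q (trg (whisker A \<eta> K))"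
      using that natural_transformation_whisker[OF K] F.is_functor_axioms G.is_functor_axioms
      by (auto simp: whisker_def PQ)
  qed
  show ?thesis
  proof (intro is_functor.intro is_functor_axioms.intro, goal_cases)
    case 1
    show ?case by (fact BC.category_axioms)
  next
    case 2
    show ?case by (intro category_full_subcategory category_functor_category)
  next
    case 3
    show ?case using is_functor_comp_functor[OF K] PQ by (auto simp: precomposition_def)
  next
    case 4
    show ?case using nat by (auto simp: precomposition_def)
  next
    case (5 \<eta> F G)
    then interpret natural_transformation B C \<eta>
      by (simp add: in_hom_full_subcategory in_hom_functor_category)
    show ?case
      using 5 nat[of \<eta>] F.is_functor_axioms G.is_functor_axioms
      by (auto simp: in_hom_full_subcategory in_hom_functor_category precomposition_def whisker_def PQ)
  next
    \<comment> \<open>\<open>natural_transformation_Ide\<close> places the identity among the arrows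
      on which the restricted arrow map evaluates, and \<open>K.fobj_in\<close> does the same for
      its components at \<open>fobj K x\<close>. The next case treats composites likewise.\<close>
    case (6 F)
    then show ?case
      using natural_transformation_Ide[of B C F] K.fobj_in
      by (auto simp: precomposition_def whisker_def comp_functor_def fun_eq_iff restrict_def)
  next
    case (7 \<eta> F G \<theta> H)
    then show ?case
      using natural_transformation_Comp[of B C \<eta> \<theta>] K.fobj_in
      by (auto simp: in_hom_full_subcategory in_hom_functor_category precomposition_def
          whisker_def fun_eq_iff restrict_def)
  qed
qed

section \<open>Restriction of narratives\<close>

lemma is_functor_inclusion:
  assumes "S \<subseteq> T"
  shows "is_functor (posetal S) (posetal T) (inclusion S)"
  by (intro is_functor.intro is_functor_axioms.intro category_posetal)
    (use assms in \<open>auto simp: in_hom_posetal inclusion_def\<close>, auto simp: posetal_def)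

text \<open>These are the four sides of the gluing square. Their membership in
  \<open>Arr (posetal S)\<close> allows the restricted arrow map of the composite with
  \<open>inclusion S\<close> to be evaluated on them.\<close>

lemma cover_Arr_posetal:
  assumes "is_cover U p V W" "{U, V, W, interval_of p} \<subseteq> S"
  shows "(interval_of p, V) \<in> Arr (posetal S)" "(interval_of p, W) \<in> Arr (posetal S)"
    "(V, U) \<in> Arr (posetal S)" "(W, U) \<in> Arr (posetal S)"
  \<comment> \<open>For \<open>U = [a, b]\<close>, the interval \<open>V\<close> yields
    \<open>a \<le> p\<close> and \<open>W\<close> yields \<open>p \<le> b\<close>; all four
    inclusions follow.\<close>
  using assms lower_le_upper[of V] lower_le_upper[of W]
  by (auto simp: posetal_def is_cover_def less_eq_interval_def)

lemma is_sheaf_comp_inclusion: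
  assumes "S \<subseteq> T" "is_sheaf T C F"
  shows "is_sheaf S C (comp_functor (op_cat (posetal S)) F (inclusion S))"
proof -
  have "is_functor (op_cat (posetal S)) C (comp_functor (op_cat (posetal S)) F (inclusion S))"
    using assms is_functor_comp_functor[OF is_functor_op_cat[OF is_functor_inclusion]]
    by (auto simp: is_sheaf_def)
  moreover have "is_pullback C (farr F (interval_of p, V)) (farr F (interval_of p, W))
      (farr F (V, U)) (farr F (W, U))"
    if "is_cover U p V W" "{U, V, W, interval_of p} \<subseteq> S" for U p V W
    using assms that unfolding is_sheaf_def by (meson subset_trans)
  \<comment> \<open>By \<open>cover_Arr_posetal\<close> the restricted functor takes the same values
    as \<open>F\<close> on the square, so its gluing condition is the one just obtained for
    \<open>F\<close>.\<close>
  ultimately show ?thesis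
    unfolding is_sheaf_def by (auto simp: comp_functor_def inclusion_def cover_Arr_posetal)
qed

lemma is_cosheaf_comp_inclusion:
  assumes "S \<subseteq> T" "is_cosheaf T C F"
  shows "is_cosheaf S C (comp_functor (posetal S) F (inclusion S))"
proof -
  have "is_functor (posetal S) C (comp_functor (posetal S) F (inclusion S))"
    using assms is_functor_comp_functor[OF is_functor_inclusion] by (auto simp: is_cosheaf_def)
  moreover have "is_pushout C (farr F (interval_of p, V)) (farr F (interval_of p, W))
      (farr F (V, U)) (farr F (W, U))"
    if "is_cover U p V W" "{U, V, W, interval_of p} \<subseteq> S" for U p V W
    using assms that unfolding is_cosheaf_def by (meson subset_trans)
  ultimately show ?thesis
    unfolding is_cosheaf_def by (auto simp: comp_functor_def inclusion_def cover_Arr_posetal)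
qed

text \<open>Here \<open>inclusion S\<close> is read as a functor between the opposite posets, with
  \<open>is_sheaf T C\<close> and \<open>is_sheaf S C\<close> selecting the objects.\<close>

lemma is_functor_precomposition_Pe:
  assumes "S \<subseteq> T"
  shows "is_functor (Pe T C) (Pe S C) (precomposition (Pe T C) (op_cat (posetal S)) (inclusion S))"
  unfolding Pe_def
  using assms
  by (intro is_functor_precomposition is_functor_op_cat is_functor_inclusion is_sheaf_comp_inclusion)

lemma is_functor_precomposition_Cu:
  assumes "S \<subseteq> T"
  shows "is_functor (Cu T C) (Cu S C) (precomposition (Cu T C) (posetal S) (inclusion S))"
  unfolding Cu_def
  using assms
  by (intro is_functor_precomposition is_functor_inclusion is_cosheaf_comp_inclusion)

theorem proposition2p19:
  fixes C :: "('o, 'a) cat"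
    and S T :: "real interval set"
    and S' T' :: "nat interval set"
  assumes "category C"
  shows "(time_category T \<and> sub_join_semilattice S T \<longrightarrow>
            (has_limits TYPE('u::infinite) C \<longrightarrow>
               is_functor (Pe T C) (Pe S C) (precomposition (Pe T C) (op_cat (posetal S)) (inclusion S))) \<and>
            (has_colimits TYPE('u) C \<longrightarrow>
               is_functor (Cu T C) (Cu S C) (precomposition (Cu T C) (posetal S) (inclusion S)))) \<and>
         (time_category T' \<and> sub_join_semilattice S' T' \<longrightarrow>
            (has_limits TYPE('u) C \<longrightarrow>
               is_functor (Pe T' C) (Pe S' C) (precomposition (Pe T' C) (op_cat (posetal S')) (inclusion S'))) \<and>
            (has_colimits TYPE('u) C \<longrightarrow>
               is_functor (Cu T' C) (Cu S' C) (precomposition (Cu T' C) (posetal S') (inclusion S'))))"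
  \<comment> \<open>The two lemmas are polymorphic in the type of endpoints, so the real and the
    natural case are both instances; \<open>sub_join_semilattice_def\<close> supplies the inclusion
    of the subset.\<close>
  by (simp add: sub_join_semilattice_def is_functor_precomposition_Pe is_functor_precomposition_Cu)

end
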